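(* Let $\mathbb{T}$ be a time scale, $\alpha\in(0,1]$ and $a,b\in\mathbb{T}$. If $f,g,h:[a,b]\to\mathbb{R}$ are rd-continuous, then $$\int_a^b|f(t)g(t)|\,|h(t)|\,\Delta^\alpha t\le\left[\int_a^b|f(t)|^p|h(t)|\,\Delta^\alpha t\right]^{\frac1p}\left[\int_a^b|g(t)|^q|h(t)|\,\Delta^\alpha t\right]^{\frac1q},$$ where $p>1$ and $\frac1p+\frac1q=1$.
   Context: A time scale $\mathbb{T}$ is a nonempty closed subset of $\mathbb{R}$. Here $[a,b]$ denotes the time-scale interval $\{t\in\mathbb{T}:a\le t\le b\}$. A function is rd-continuous if it is continuous at right-dense points and has finite left-sided limits at left-dense points. The $\alpha$-fractional integral of a function $f$ is $\int f(t)\,\Delta^\alpha t:=\int f(t)\,t^{\alpha-1}\,\Delta t$, where the right-hand side is the usual (indefinite) Hilger delta-integral on $\mathbb{T}$. Writing $F_\alpha(t)=\int f(t)\,\Delta^\alpha t$, the Cauchy $\alpha$-fractional integral is $\int_a^b f(t)\,\Delta^\alpha t:=F_\alpha(b)-F_\alpha(a)$ for $a,b\in\mathbb{T}$.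
   Formalization: Assumes a ≤ b and, since t^(α-1) is otherwise undefined or its integral may diverge: α = 1, or a > 0, or a = 0 not right-scattered with both right-hand integrals existing; the English puts no such condition on a, b or the integrals. *)

theory Defs
  imports "HOL-Analysis.Analysis"
begin

definition time_scale :: "real set \<Rightarrow> bool" where
  "time_scale T \<longleftrightarrow> T \<noteq> {} \<and> closed T"

definition ts_interval :: "real set \<Rightarrow> real \<Rightarrow> real \<Rightarrow> real set" where
  "ts_interval T a b = {t \<in> T. a \<le> t \<and> t \<le> b}"

text \<open>The usual conventions \<open>inf {} = sup T\<close> and \<open>sup {} = inf T\<close> make
  the jump operators fix the maximum and the minimum of \<open>T\<close>, respectively.\<close>

definition fwd_jump :: "real set \<Rightarrow> real \<Rightarrow> real" where
  "fwd_jump T t = (if \<exists>s\<in>T. t < s then Inf {s \<in> T. t < s} else t)"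

definition bwd_jump :: "real set \<Rightarrow> real \<Rightarrow> real" where
  "bwd_jump T t = (if \<exists>s\<in>T. s < t then Sup {s \<in> T. s < t} else t)"

definition right_scattered :: "real set \<Rightarrow> real \<Rightarrow> bool" where
  "right_scattered T t \<longleftrightarrow> t < fwd_jump T t"

definition left_scattered :: "real set \<Rightarrow> real \<Rightarrow> bool" where
  "left_scattered T t \<longleftrightarrow> bwd_jump T t < t"

definition right_dense :: "real set \<Rightarrow> real \<Rightarrow> bool" where
  "right_dense T t \<longleftrightarrow> (\<exists>s\<in>T. t < s) \<and> fwd_jump T t = t"

definition left_dense :: "real set \<Rightarrow> real \<Rightarrow> bool" where
  "left_dense T t \<longleftrightarrow> (\<exists>s\<in>T. s < t) \<and> bwd_jump T t = t"

definition rd_continuous :: "real set \<Rightarrow> (real \<Rightarrow> real) \<Rightarrow> bool" where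
  "rd_continuous T f \<longleftrightarrow>
     (\<forall>t\<in>T. (right_dense T t \<longrightarrow> continuous (at t within T) f) \<and>
            (left_dense T t \<longrightarrow> (\<exists>l. (f \<longlongrightarrow> l) (at t within (T \<inter> {..<t})))))"

text \<open>The set usually written \<open>T\<^sup>\<kappa>\<close>: a left-scattered maximum is removed.\<close>

definition ts_kappa :: "real set \<Rightarrow> real set" where
  "ts_kappa T = {t \<in> T. \<not> ((\<forall>s\<in>T. s \<le> t) \<and> left_scattered T t)}"

definition has_delta_derivative ::
  "real set \<Rightarrow> (real \<Rightarrow> real) \<Rightarrow> real \<Rightarrow> real \<Rightarrow> bool" where
  "has_delta_derivative T F d t \<longleftrightarrow>
     (\<forall>\<epsilon>>0. \<exists>\<delta>>0. \<forall>s\<in>T. \<bar>s - t\<bar> < \<delta> \<longrightarrow>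
        \<bar>F (fwd_jump T t) - F s - d * (fwd_jump T t - s)\<bar> \<le> \<epsilon> * \<bar>fwd_jump T t - s\<bar>)"

text \<open>Hilger pre-antiderivative: \<open>F\<close> is continuous and has delta derivative \<open>f\<close> on
  \<open>T\<^sup>\<kappa>\<close> outside a countable set without right-scattered points.  Rd-continuous
  functions may be discontinuous at left-dense maxima, so that the exceptional set
  is needed even for them on a compact time scale.\<close>

definition pre_antiderivative :: "real set \<Rightarrow> (real \<Rightarrow> real) \<Rightarrow> (real \<Rightarrow> real) \<Rightarrow> bool" where
  "pre_antiderivative T f F \<longleftrightarrow>
     continuous_on T F \<and>
     (\<exists>D \<subseteq> ts_kappa T.
        countable (ts_kappa T - D) \<and>
        (\<forall>t \<in> ts_kappa T - D. \<not> right_scattered T t) \<and>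
        (\<forall>t \<in> D. has_delta_derivative T F (f t) t))"

definition delta_integrable :: "real set \<Rightarrow> (real \<Rightarrow> real) \<Rightarrow> bool" where
  "delta_integrable T f \<longleftrightarrow> (\<exists>F. pre_antiderivative T f F)"

text \<open>The indefinite integral is determined up to an additive constant; a
  representative is chosen.\<close>

definition indefinite_delta_integral :: "real set \<Rightarrow> (real \<Rightarrow> real) \<Rightarrow> real \<Rightarrow> real" where
  "indefinite_delta_integral T f = (SOME F. pre_antiderivative T f F)"

text \<open>The weight \<open>t\<^sup>\<alpha>\<^sup>-\<^sup>1\<close>.  For \<open>\<alpha> = 1\<close> it is constantly \<open>1\<close>, whereas
  \<open>0 powr 0 = 0\<close>.  For \<open>\<alpha> < 1\<close> it is meaningful for \<open>t > 0\<close> only.\<close>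

definition frac_weight :: "real \<Rightarrow> real \<Rightarrow> real" where
  "frac_weight \<alpha> t = (if \<alpha> = 1 then 1 else t powr (\<alpha> - 1))"

definition frac_integrable :: "real set \<Rightarrow> real \<Rightarrow> (real \<Rightarrow> real) \<Rightarrow> bool" where
  "frac_integrable T \<alpha> f \<longleftrightarrow> delta_integrable T (\<lambda>t. f t * frac_weight \<alpha> t)"

definition indefinite_frac_integral ::
  "real set \<Rightarrow> real \<Rightarrow> (real \<Rightarrow> real) \<Rightarrow> real \<Rightarrow> real" where
  "indefinite_frac_integral T \<alpha> f = indefinite_delta_integral T (\<lambda>t. f t * frac_weight \<alpha> t)"

definition frac_integral ::
  "real set \<Rightarrow> real \<Rightarrow> real \<Rightarrow> real \<Rightarrow> (real \<Rightarrow> real) \<Rightarrow> real" where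
  "frac_integral T \<alpha> a b f =
     indefinite_frac_integral T \<alpha> f b - indefinite_frac_integral T \<alpha> f a"

text \<open>When the weight makes sense on the interval \<open>J\<close> with left end point \<open>a\<close>,
  and \<open>\<phi>\<close> has an integral there.  For \<open>\<alpha> < 1\<close> and \<open>a = 0\<close> the weight is singular
  at \<open>a\<close>; the integral is then improper at \<open>a\<close>, may diverge (even for \<open>\<phi> = 1\<close>), and is
  meaningless if \<open>a\<close> is right-scattered.  In the other two cases rd-continuous \<open>\<phi>\<close>
  are integrable, so nothing is required of \<open>\<phi>\<close>.\<close>

definition frac_admissible :: "real set \<Rightarrow> real \<Rightarrow> real \<Rightarrow> (real \<Rightarrow> real) \<Rightarrow> bool" where
  "frac_admissible J \<alpha> a \<phi> \<longleftrightarrow>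
     \<alpha> = 1 \<or> a > 0 \<or> (a = 0 \<and> \<not> right_scattered J a \<and> frac_integrable J \<alpha> \<phi>)"

end

theory Submission
  imports Defs
begin

text \<open>The delta integral on a compact time scale with end points \<open>a\<close> and \<open>b\<close> is an ordinary
  Henstock--Kurzweil integral over \<open>{a..b}\<close>.  Extend \<open>u\<close> to a function that keeps the value \<open>u c\<close>
  on each gap that follows a right-scattered point \<open>c\<close> (\<open>step_extension\<close>).  If \<open>F\<close> is an
  antiderivative of \<open>u\<close>, interpolate it linearly across the gaps.  The result is continuous and,
  apart from the gap ends and the exceptional points, which are countable in number, it is
  differentiable with derivative the step extension.  A fundamental theorem of calculus that tolerates
  countably many exceptions (\<open>has_integral_derivative_off_countable\<close>) then gives
  \<open>F b - F a\<close> as the integral of the step extension (\<open>pre_antiderivative_has_integral\<close>).  Since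
  integrability is part of its conclusion, it also covers a weight that is singular at \<open>a = 0\<close>.

  Once the three fractional integrals are integrals over \<open>{a..b}\<close>, Hoelder's inequality follows
  from Young's inequality (\<open>Holder_has_integral\<close>).  Since a fractional integral is read off an
  arbitrarily chosen antiderivative, each of the three needs to exist.  Conversely to the above,
  an indefinite integral of the step extension is an antiderivative
  (\<open>pre_antiderivative_integral\<close>).  Rd-continuous functions have step extensions with one-sided
  limits everywhere, and these are integrable (\<open>rd_continuous_integrable\<close>).  This settles the case
  of a regular weight.  For a singular weight, the two integrals on the right exist by admissibility,
  and the integrand on the left is measurable and, by Young's inequality, dominated by the sum of
  the other two (\<open>frac_integrable_dominated\<close>).\<close>

section \<open>The fundamental theorem of calculus with countably many exceptions\<close>

text \<open>A series of steps at the points of a countable set.  Each point gets two steps of equal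
  height, one taken just before and one just after it, so that a nondegenerate interval is charged
  the full height \<open>c s\<close> even if \<open>s\<close> is one of its end points.  Summing the charges over a tagged
  division then telescopes, no matter how often a tag is repeated.\<close>

lemma countable_step_function:
  fixes S :: "real set"
  assumes "countable S"
  obtains \<theta> c :: "real \<Rightarrow> real" where
    "mono \<theta>" "\<And>x y. \<theta> y - \<theta> x \<le> 4" "\<And>s. 0 < c s"
    "\<And>s u v. s \<in> S \<Longrightarrow> u \<le> s \<Longrightarrow> s \<le> v \<Longrightarrow> u < v \<Longrightarrow> c s \<le> \<theta> v - \<theta> u"
proof -
  define r where "r = from_nat_into S"
  define \<tau> where "\<tau> x n = (1/2)^n * (of_bool (r n < x) + of_bool (r n \<le> x) :: real)" for x n
  define \<theta> where "\<theta> x = suminf (\<tau> x)" for x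
  have geo: "summable (\<lambda>n. 2 * (1/2::real)^n)" "(\<Sum>n. 2 * (1/2::real)^n) = 4"
    using suminf_geometric[of "1/2::real"]
    by (auto simp: suminf_mult summable_mult)
  have \<tau>_bounds: "0 \<le> \<tau> x n" "\<tau> x n \<le> 2 * (1/2)^n" for x n
    by (auto simp: \<tau>_def)
  have summ: "summable (\<tau> x)" for x
    by (rule summable_comparison_test'[OF geo(1)]) (use \<tau>_bounds in auto)
  have \<tau>_mono: "\<tau> x n \<le> \<tau> y n" if "x \<le> y" for x y n
    using that by (auto simp: \<tau>_def)
  have "mono \<theta>"
    unfolding \<theta>_def by (intro monoI suminf_le \<tau>_mono summ)
  moreover have "\<theta> y - \<theta> x \<le> 4" for x y
  proof -
    have "\<theta> y \<le> 4"
      unfolding \<theta>_def geo(2)[symmetric] by (intro suminf_le \<tau>_bounds summ geo)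
    moreover have "0 \<le> \<theta> x"
      unfolding \<theta>_def by (intro suminf_nonneg summ \<tau>_bounds)
    ultimately show ?thesis by linarith
  qed
  moreover have "(1/2) ^ to_nat_on S s \<le> \<theta> v - \<theta> u"
    if "s \<in> S" "u \<le> s" "s \<le> v" "u < v" for s u v
  proof -
    define n where "n = to_nat_on S s"
    have "r n = s"
      using assms that by (simp add: r_def n_def)
    then have "(1/2) ^ n \<le> \<tau> v n - \<tau> u n"
      using that by (auto simp: \<tau>_def of_bool_def)
    also have "\<dots> = (\<Sum>k\<in>{n}. \<tau> v k - \<tau> u k)"
      by simp
    also have "\<dots> \<le> (\<Sum>k. \<tau> v k - \<tau> u k)"
      by (rule sum_le_suminf) (use that in \<open>auto intro!: summable_diff summ \<tau>_mono\<close>)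
    also have "\<dots> = \<theta> v - \<theta> u"
      unfolding \<theta>_def by (rule suminf_diff[symmetric]) (rule summ)+
    finally show ?thesis
      by (simp add: n_def)
  qed
  ultimately show thesis
    by (intro that[of \<theta> "\<lambda>s. (1/2) ^ to_nat_on S s"]) auto
qed

text \<open>At a point where \<open>F\<close> is differentiable, the increments of \<open>F\<close> over small intervals around it
  are \<open>f x\<close> times the length, up to \<open>e\<close> times the length.  At one of the countably many other
  points, continuity makes the error smaller than any prescribed number, and the step function
  allots to the points numbers with bounded sum.\<close>

proposition has_integral_derivative_off_countable:
  fixes F f :: "real \<Rightarrow> real"
  assumes ab: "a \<le> b" and S: "countable S" and cont: "continuous_on {a..b} F"
    and deriv: "\<And>x. x \<in> {a..b} - S \<Longrightarrow> (F has_vector_derivative f x) (at x within {a..b})"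
  shows "(f has_integral (F b - F a)) {a..b}"
proof -
  obtain \<theta> c :: "real \<Rightarrow> real" where \<theta>: "mono \<theta>" "\<And>x y. \<theta> y - \<theta> x \<le> 4" "\<And>s. 0 < c s"
    "\<And>s u v. s \<in> S \<Longrightarrow> u \<le> s \<Longrightarrow> s \<le> v \<Longrightarrow> u < v \<Longrightarrow> c s \<le> \<theta> v - \<theta> u"
    using countable_step_function[OF S] by blast
  define \<psi> where "\<psi> x = x + \<theta> x" for x
  have \<psi>_mono: "\<psi> u \<le> \<psi> v" "v - u \<le> \<psi> v - \<psi> u" if "u \<le> v" for u v
    using monoD[OF \<theta>(1) that] that by (auto simp: \<psi>_def)
  have small_error: "\<exists>d>0. x \<in> {a..b} \<longrightarrow> (\<forall>u\<in>{a..b}. \<forall>v\<in>{a..b}. u \<le> x \<and> x \<le> v \<and> x - u < d \<and> v - x < d \<longrightarrow>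
      \<bar>(v - u) * f x - (F v - F u)\<bar> \<le> e * (\<psi> v - \<psi> u))" if e: "e > 0" for e x
  proof (cases "x \<in> {a..b}")
    case x: True
    show ?thesis
    proof (cases "x \<in> S")
      case True
      \<comment> \<open>The error at an exceptional point is the sum of four terms, two for each side.\<close>
      define \<eta> where "\<eta> = e * c x / 4"
      have \<eta>: "\<eta> > 0"
        using e \<theta>(3) by (simp add: \<eta>_def)
      obtain d1 where d1: "d1 > 0" "\<And>y. y \<in> {a..b} \<Longrightarrow> \<bar>y - x\<bar> < d1 \<Longrightarrow> \<bar>F y - F x\<bar> < \<eta>"
        using cont x \<eta> unfolding continuous_on_iff dist_real_def by metis
      define d where "d = min d1 (\<eta> / (\<bar>f x\<bar> + 1))"
      have "d > 0"
        using d1 \<eta> by (simp add: d_def)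
      moreover have "\<bar>(v - u) * f x - (F v - F u)\<bar> \<le> e * (\<psi> v - \<psi> u)"
        if uv: "u \<in> {a..b}" "v \<in> {a..b}" "u \<le> x" "x \<le> v" "x - u < d" "v - x < d" for u v
      proof (cases "u = v")
        case False
        then have "u < v"
          using uv by simp
        have small: "\<bar>(y - x) * f x\<bar> \<le> \<eta>" if "\<bar>y - x\<bar> < d" for y
        proof -
          have "\<bar>(y - x) * f x\<bar> \<le> (\<eta> / (\<bar>f x\<bar> + 1)) * (\<bar>f x\<bar> + 1)"
            unfolding abs_mult by (intro mult_mono) (use that \<eta> in \<open>auto simp: d_def\<close>)
          then show ?thesis by simp
        qed
        have "(v - u) * f x - (F v - F u)
            = ((v - x) * f x - (u - x) * f x) - ((F v - F x) - (F u - F x))"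
          by (simp add: algebra_simps)
        then have "\<bar>(v - u) * f x - (F v - F u)\<bar> \<le> 4 * \<eta>"
          using small[of u] small[of v] d1(2)[of u] d1(2)[of v] uv by (auto simp: d_def)
        also have "\<dots> \<le> e * (\<theta> v - \<theta> u)"
          using \<theta>(4)[OF True uv(3,4) \<open>u < v\<close>] e by (simp add: \<eta>_def)
        also have "\<dots> \<le> e * (\<psi> v - \<psi> u)"
          using e \<open>u < v\<close> by (simp add: \<psi>_def)
        finally show ?thesis .
      qed auto
      ultimately show ?thesis by blast
    next
      case False
      obtain d where d: "d > 0" "\<And>y. y \<in> {a..b} \<Longrightarrow> \<bar>y - x\<bar> < d \<Longrightarrow>
          \<bar>F y - F x - (y - x) * f x\<bar> \<le> e * \<bar>y - x\<bar>"
        using deriv[of x] x False e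
        unfolding has_vector_derivative_def has_derivative_within_alt by auto
      moreover have "\<bar>(v - u) * f x - (F v - F u)\<bar> \<le> e * (\<psi> v - \<psi> u)"
        if uv: "u \<in> {a..b}" "v \<in> {a..b}" "u \<le> x" "x \<le> v" "x - u < d" "v - x < d" for u v
      proof -
        have "(v - u) * f x - (F v - F u)
            = (F u - F x - (u - x) * f x) - (F v - F x - (v - x) * f x)"
          by (simp add: algebra_simps)
        then have "\<bar>(v - u) * f x - (F v - F u)\<bar> \<le> e * \<bar>u - x\<bar> + e * \<bar>v - x\<bar>"
          using d(2)[of u] d(2)[of v] uv by auto
        also have "\<dots> = e * (v - u)"
          using uv by (simp add: algebra_simps)
        also have "\<dots> \<le> e * (\<psi> v - \<psi> u)"
          using e \<psi>_mono[of u v] uv by (intro mult_left_mono) auto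
        finally show ?thesis .
      qed
      ultimately show ?thesis by blast
    qed
  qed (auto intro: exI[of _ 1])
  show ?thesis
    unfolding has_integral box_real[symmetric]
  proof (intro allI impI)
    fix e :: real
    assume "e > 0"
    define e' where "e' = e / (b - a + 5)"
    have e': "e' > 0"
      using \<open>e > 0\<close> ab by (simp add: e'_def)
    obtain d where d: "\<And>x. d x > 0" "\<And>x u v. x \<in> {a..b} \<Longrightarrow> u \<in> {a..b} \<Longrightarrow> v \<in> {a..b} \<Longrightarrow> u \<le> x \<Longrightarrow>
        x \<le> v \<Longrightarrow> x - u < d x \<Longrightarrow> v - x < d x \<Longrightarrow>
        \<bar>(v - u) * f x - (F v - F u)\<bar> \<le> e' * (\<psi> v - \<psi> u)"
      using small_error[OF e'] by metis
    show "\<exists>\<gamma>. gauge \<gamma> \<and> (\<forall>\<D>. \<D> tagged_division_of (cbox a b) \<and> \<gamma> fine \<D> \<longrightarrow>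
        norm ((\<Sum>(x, K)\<in>\<D>. measure lborel K *\<^sub>R f x) - (F b - F a)) < e)"
    proof (intro exI conjI allI impI)
      show "gauge (\<lambda>x. ball x (d x))"
        using d(1) by (rule gauge_ball_dependent[rule_format])
    next
      fix p
      assume "p tagged_division_of cbox a b \<and> (\<lambda>x. ball x (d x)) fine p"
      then have p: "p tagged_division_of cbox a b" and fine: "(\<lambda>x. ball x (d x)) fine p"
        by auto
      have tele: "(\<Sum>(x,K)\<in>p. G (Sup K) - G (Inf K)) = G b - G a" for G :: "real \<Rightarrow> real"
        using additive_tagged_division_1[OF ab, of p G] p by simp
      have "(\<Sum>(x, K)\<in>p. measure lborel K *\<^sub>R f x) - (F b - F a)
          = (\<Sum>(x, K)\<in>p. measure lborel K * f x - (F (Sup K) - F (Inf K)))"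
        unfolding tele[of F, symmetric] by (simp add: sum_subtractf case_prod_unfold)
      also have "norm \<dots> \<le> (\<Sum>(x, K)\<in>p. e' * (\<psi> (Sup K) - \<psi> (Inf K)))"
      proof (intro sum_norm_le, safe)
        fix x K
        assume xK: "(x, K) \<in> p"
        obtain u v where K: "K = cbox u v"
          using p xK by blast
        have "x \<in> K" "K \<subseteq> {a..b}"
          using p xK by auto
        have "K \<subseteq> ball x (d x)"
          using fine xK by blast
        have "u \<le> v" "u \<in> K" "v \<in> K"
          using \<open>x \<in> K\<close> by (auto simp: K)
        then have "u \<in> ball x (d x)" "v \<in> ball x (d x)" "u \<in> {a..b}" "v \<in> {a..b}" "x \<in> {a..b}"
          using \<open>x \<in> K\<close> \<open>K \<subseteq> {a..b}\<close> \<open>K \<subseteq> ball x (d x)\<close> by blast+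
        then show "norm (measure lborel K * f x - (F (Sup K) - F (Inf K))) \<le> e' * (\<psi> (Sup K) - \<psi> (Inf K))"
          using d(2)[of x u v] \<open>x \<in> K\<close> \<open>u \<le> v\<close> by (simp add: K dist_real_def)
      qed
      also have "\<dots> = e' * (\<psi> b - \<psi> a)"
        unfolding tele[of \<psi>, symmetric] by (simp add: sum_distrib_left case_prod_unfold)
      also have "\<dots> \<le> e' * (b - a + 4)"
        using e' \<theta>(2)[of b a] by (intro mult_left_mono) (auto simp: \<psi>_def)
      also have "\<dots> < e' * (b - a + 5)"
        using e' by simp
      also have "\<dots> = e"
        using ab by (simp add: e'_def)
      finally show "norm ((\<Sum>(x, K)\<in>p. measure lborel K *\<^sub>R f x) - (F b - F a)) < e" .
    qed
  qed
qed

section \<open>Regulated functions\<close>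

text \<open>Around each point, a function with one-sided limits is within \<open>e\<close> of a function that is
  constant on either side of the point.  A tagged division fine enough for these neighbourhoods
  glues such functions into an integrable uniform approximation.\<close>

lemma regulated_integrable_on:
  fixes f :: "real \<Rightarrow> real"
  assumes left: "\<And>x. a < x \<Longrightarrow> x \<le> b \<Longrightarrow> \<exists>l. (f \<longlongrightarrow> l) (at_left x)"
    and right: "\<And>x. a \<le> x \<Longrightarrow> x < b \<Longrightarrow> \<exists>l. (f \<longlongrightarrow> l) (at_right x)"
  shows "f integrable_on {a..b}"
  unfolding box_real[symmetric]
proof (rule integrable_uniform_limit)
  fix e :: real
  assume e: "e > 0"
  have L: "\<exists>l d. d > 0 \<and> (\<forall>y. a \<le> y \<and> x - d < y \<and> y < x \<longrightarrow> \<bar>f y - l\<bar> \<le> e)"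
    if x: "x \<in> {a..b}" for x
  proof (cases "x = a")
    case False
    then obtain l where "(f \<longlongrightarrow> l) (at_left x)"
      using left[of x] x by auto
    then have "eventually (\<lambda>y. dist (f y) l < e) (at_left x)"
      using e by (rule tendstoD)
    then obtain z where "z < x" "\<And>y. z < y \<Longrightarrow> y < x \<Longrightarrow> dist (f y) l < e"
      unfolding eventually_at_left_field by blast
    then show ?thesis
      by (intro exI[of _ l] exI[of _ "x - z"]) (auto simp: dist_real_def less_imp_le)
  qed (auto intro: exI[of _ 1])
  have R: "\<exists>r d. d > 0 \<and> (\<forall>y. y \<le> b \<and> x < y \<and> y < x + d \<longrightarrow> \<bar>f y - r\<bar> \<le> e)"
    if x: "x \<in> {a..b}" for x
  proof (cases "x = b")
    case False
    then obtain l where "(f \<longlongrightarrow> l) (at_right x)"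
      using right[of x] x by auto
    then have "eventually (\<lambda>y. dist (f y) l < e) (at_right x)"
      using e by (rule tendstoD)
    then obtain z where "x < z" "\<And>y. x < y \<Longrightarrow> y < z \<Longrightarrow> dist (f y) l < e"
      unfolding eventually_at_right_field by blast
    then show ?thesis
      by (intro exI[of _ l] exI[of _ "z - x"]) (auto simp: dist_real_def less_imp_le)
  qed (auto intro: exI[of _ 1])
  have "\<exists>l r d. d > 0 \<and> (x \<in> {a..b} \<longrightarrow> (\<forall>y\<in>{a..b}. \<bar>y - x\<bar> < d \<longrightarrow>
      (y < x \<longrightarrow> \<bar>f y - l\<bar> \<le> e) \<and> (x < y \<longrightarrow> \<bar>f y - r\<bar> \<le> e)))" for x
  proof (cases "x \<in> {a..b}")
    case True
    obtain l d1 where 1: "d1 > 0" "\<And>y. a \<le> y \<Longrightarrow> x - d1 < y \<Longrightarrow> y < x \<Longrightarrow> \<bar>f y - l\<bar> \<le> e"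
      using L[OF True] by blast
    obtain r d2 where 2: "d2 > 0" "\<And>y. y \<le> b \<Longrightarrow> x < y \<Longrightarrow> y < x + d2 \<Longrightarrow> \<bar>f y - r\<bar> \<le> e"
      using R[OF True] by blast
    show ?thesis
      by (intro exI[of _ l] exI[of _ r] exI[of _ "min d1 d2"]) (use 1 2 in auto)
  qed (use gt_ex in auto)
  then obtain l r d where d: "\<And>x. d x > 0"
    and near: "\<And>x y. x \<in> {a..b} \<Longrightarrow> y \<in> {a..b} \<Longrightarrow> \<bar>y - x\<bar> < d x \<Longrightarrow>
      (y < x \<longrightarrow> \<bar>f y - l x\<bar> \<le> e) \<and> (x < y \<longrightarrow> \<bar>f y - r x\<bar> \<le> e)"
    by metis
  have "gauge (\<lambda>x. ball x (d x))"
    using d by (rule gauge_ball_dependent[rule_format])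
  then obtain p where p: "p tagged_division_of cbox a b" and fine: "(\<lambda>x. ball x (d x)) fine p"
    using fine_division_exists by blast
  have "\<forall>K\<in>snd ` p. \<exists>g. (\<forall>y\<in>K. norm (f y - g y) \<le> e) \<and> g integrable_on K"
  proof clarsimp
    fix x K
    assume xK: "(x, K) \<in> p"
    obtain u v where K: "K = cbox u v"
      using p xK by blast
    have x: "x \<in> K" and sub: "K \<subseteq> {a..b}" and ball: "K \<subseteq> ball x (d x)"
      using p xK fine by auto
    define g where "g y = (if y < x then l x else if y = x then f x else r x)" for y
    have "g integrable_on {u..x}"
      by (rule integrable_spike_finite[of "{x}" _ _ "\<lambda>_. l x"]) (auto simp: g_def)
    moreover have "g integrable_on {x..v}"
      by (rule integrable_spike_finite[of "{x}" _ _ "\<lambda>_. r x"]) (auto simp: g_def)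
    ultimately have "g integrable_on K"
      using x unfolding K
      by (auto intro: Henstock_Kurzweil_Integration.integrable_combine)
    moreover have "\<bar>f y - g y\<bar> \<le> e" if "y \<in> K" for y
    proof -
      have "y \<in> {a..b}" "x \<in> {a..b}" "\<bar>y - x\<bar> < d x"
        using that x sub ball by (auto simp: dist_real_def)
      then show ?thesis
        using near[of x y] e by (auto simp: g_def)
    qed
    ultimately show "\<exists>g. (\<forall>y\<in>K. \<bar>f y - g y\<bar> \<le> e) \<and> g integrable_on K"
      by blast
  qed
  then show "\<exists>g. (\<forall>x\<in>cbox a b. norm (f x - g x) \<le> e) \<and> g integrable_on cbox a b"
    using approximable_on_division[OF less_imp_le[OF e] division_of_tagged_division[OF p]]
    by metis
qed

section \<open>Hoelder's inequality for weighted integrals\<close>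

text \<open>Young's inequality is integrated after division of \<open>F\<close> by \<open>(A + e) powr (1/p)\<close> and of \<open>G\<close> by
  \<open>(B + e) powr (1/q)\<close>, and \<open>e\<close> then tends to \<open>0\<close>.  The summand \<open>e\<close> keeps the divisors positive
  even if one of the integrals vanishes.\<close>

lemma Holder_has_integral:
  fixes F G W :: "real \<Rightarrow> real"
  assumes p: "p > 1" and pq: "1 / p + 1 / q = 1"
    and nonneg: "\<And>x. x \<in> S \<Longrightarrow> 0 \<le> F x" "\<And>x. x \<in> S \<Longrightarrow> 0 \<le> G x" "\<And>x. x \<in> S \<Longrightarrow> 0 \<le> W x"
    and A: "((\<lambda>x. F x powr p * W x) has_integral A) S"
    and B: "((\<lambda>x. G x powr q * W x) has_integral B) S"
    and I: "((\<lambda>x. F x * G x * W x) has_integral I) S"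
  shows "I \<le> A powr (1 / p) * B powr (1 / q)"
proof -
  have q: "q > 1"
    using p pq by (smt (verit) divide_less_eq_1_pos zero_less_divide_1_iff)
  have AB: "A \<ge> 0" "B \<ge> 0"
    by (auto intro!: has_integral_nonneg[OF A] has_integral_nonneg[OF B] mult_nonneg_nonneg nonneg)
  have approx: "I \<le> (A + e) powr (1 / p) * (B + e) powr (1 / q)" if e: "e > 0" for e
  proof -
    define L where "L = (A + e) powr (1 / p)"
    define M where "M = (B + e) powr (1 / q)"
    have pos: "L > 0" "M > 0"
      using e AB by (auto simp: L_def M_def)
    have powers: "L powr p = A + e" "M powr q = B + e"
      using e AB p q by (auto simp: L_def M_def powr_powr)
    have "I \<le> L * M / (p * (A + e)) * A + L * M / (q * (B + e)) * B"
    proof (rule has_integral_le[OF I])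
      show "((\<lambda>x. L * M / (p * (A + e)) * (F x powr p * W x) + L * M / (q * (B + e)) * (G x powr q * W x))
          has_integral L * M / (p * (A + e)) * A + L * M / (q * (B + e)) * B) S"
        by (intro has_integral_add has_integral_mult_right A B)
      fix x
      assume x: "x \<in> S"
      have "F x * G x = L * M * (F x / L * (G x / M))"
        using pos by simp
      also have "\<dots> \<le> L * M * ((F x / L) powr p / p + (G x / M) powr q / q)"
        using pos nonneg x by (intro mult_left_mono Youngs_inequality p q pq) auto
      also have "\<dots> = L * M / (p * (A + e)) * F x powr p + L * M / (q * (B + e)) * G x powr q"
        using pos nonneg x by (simp add: powr_divide powers field_simps)
      finally have "F x * G x * W x \<le> (L * M / (p * (A + e)) * F x powr p + L * M / (q * (B + e)) * G x powr q) * W x"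
        using nonneg x by (intro mult_right_mono)
      then show "F x * G x * W x \<le> L * M / (p * (A + e)) * (F x powr p * W x) + L * M / (q * (B + e)) * (G x powr q * W x)"
        by (simp add: algebra_simps)
    qed
    also have "\<dots> = L * M * (1 / p * (A / (A + e)) + 1 / q * (B / (B + e)))"
      by (simp add: algebra_simps)
    also have "\<dots> \<le> L * M * (1 / p * 1 + 1 / q * 1)"
      using pos p q e AB by (intro mult_left_mono add_mono) auto
    also have "\<dots> = L * M"
      using pq by simp
    finally show ?thesis
      by (simp add: L_def M_def)
  qed
  have "((\<lambda>e. (A + e) powr (1 / p) * (B + e) powr (1 / q)) \<longlongrightarrow> (A + 0) powr (1 / p) * (B + 0) powr (1 / q)) (at_right 0)"
    using AB p q eventually_at_right_less[of "0::real"]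
    by (intro tendsto_intros tendsto_powr') (auto elim: eventually_mono)
  then show ?thesis
    using approx eventually_at_right_less[of "0::real"]
    by (intro tendsto_lowerbound[where F = "at_right (0::real)"]) (auto elim!: eventually_mono)
qed

section \<open>The step extension of a function on a compact time scale\<close>

definition ts_floor :: "real set \<Rightarrow> real \<Rightarrow> real" where
  "ts_floor J x = Sup {s \<in> J. s \<le> x}"

text \<open>Integrating this function over a gap \<open>[c, d)\<close> gives \<open>u c * (d - c)\<close>, which is what the delta
  integral assigns to the right-scattered point \<open>c\<close>.\<close>

definition step_extension :: "real set \<Rightarrow> (real \<Rightarrow> real) \<Rightarrow> real \<Rightarrow> real" where
  "step_extension J u x = u (ts_floor J x)"

locale compact_time_scale =
  fixes J :: "real set" and a b :: real
  assumes closed: "closed J" and subset: "J \<subseteq> {a..b}" and left_end: "a \<in> J" and right_end: "b \<in> J"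
begin

lemma bounds: "t \<in> J \<Longrightarrow> a \<le> t" "t \<in> J \<Longrightarrow> t \<le> b"
  using subset by auto

lemma ends_le: "a \<le> b"
  using bounds left_end by auto

lemma ts_floor_mem: "a \<le> x \<Longrightarrow> ts_floor J x \<in> J"
  and ts_floor_le: "a \<le> x \<Longrightarrow> ts_floor J x \<le> x"
proof -
  assume x: "a \<le> x"
  have "{s \<in> J. s \<le> x} = J \<inter> {..x}"
    by auto
  then have "closed {s \<in> J. s \<le> x}"
    using closed by (simp add: closed_Int)
  moreover have "{s \<in> J. s \<le> x} \<noteq> {}"
    using x left_end by auto
  ultimately have "Sup {s \<in> J. s \<le> x} \<in> {s \<in> J. s \<le> x}"
    by (intro closed_contains_Sup) (auto intro: bdd_aboveI[of _ x])
  then show "ts_floor J x \<in> J" "ts_floor J x \<le> x"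
    by (auto simp: ts_floor_def)
qed

lemma ts_floor_ge: "s \<in> J \<Longrightarrow> s \<le> x \<Longrightarrow> s \<le> ts_floor J x"
  unfolding ts_floor_def by (rule cSup_upper) (auto intro: bdd_aboveI[of _ x])

lemma ts_floor_eqI:
  assumes "s \<in> J" "s \<le> x" "\<And>r. r \<in> J \<Longrightarrow> r \<le> x \<Longrightarrow> r \<le> s"
  shows "ts_floor J x = s"
  unfolding ts_floor_def by (rule cSup_eq_maximum) (use assms in auto)

lemma ts_floor_id: "t \<in> J \<Longrightarrow> ts_floor J t = t"
  by (rule ts_floor_eqI) auto

lemma ts_floor_mono_on: "mono_on {a..b} (ts_floor J)"
  by (intro mono_onI ts_floor_ge ts_floor_mem) (auto intro: order_trans[OF ts_floor_le])

lemma step_extension_mem: "t \<in> J \<Longrightarrow> step_extension J u t = u t"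
  by (simp add: step_extension_def ts_floor_id)

section \<open>Jumps and gaps\<close>

lemma fwd_jump_props:
  assumes "x < b"
  shows "fwd_jump J x \<in> J" "x \<le> fwd_jump J x" "\<And>s. s \<in> J \<Longrightarrow> x < s \<Longrightarrow> fwd_jump J x \<le> s"
proof -
  let ?A = "{s \<in> J. x < s}"
  have A: "?A \<noteq> {}" "bdd_below ?A"
    using assms right_end by (auto intro: bdd_belowI[of _ x])
  have eq: "fwd_jump J x = Inf ?A"
    using assms right_end by (auto simp: fwd_jump_def)
  show "fwd_jump J x \<in> J"
    unfolding eq using closure_contains_Inf[OF A] closed closure_minimal[of ?A J] by auto
  show "x \<le> fwd_jump J x"
    unfolding eq by (rule cInf_greatest) (use A in auto)
  show "fwd_jump J x \<le> s" if "s \<in> J" "x < s" for s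
    unfolding eq by (rule cInf_lower) (use A that in auto)
qed

lemma bwd_jump_props:
  assumes "a < x"
  shows "bwd_jump J x \<in> J" "bwd_jump J x \<le> x" "\<And>s. s \<in> J \<Longrightarrow> s < x \<Longrightarrow> s \<le> bwd_jump J x"
proof -
  let ?A = "{s \<in> J. s < x}"
  have A: "?A \<noteq> {}" "bdd_above ?A"
    using assms left_end by (auto intro: bdd_aboveI[of _ x])
  have eq: "bwd_jump J x = Sup ?A"
    using assms left_end by (auto simp: bwd_jump_def)
  show "bwd_jump J x \<in> J"
    unfolding eq using closure_contains_Sup[OF A] closed closure_minimal[of ?A J] by auto
  show "bwd_jump J x \<le> x"
    unfolding eq by (rule cSup_least) (use A in auto)
  show "s \<le> bwd_jump J x" if "s \<in> J" "s < x" for s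
    unfolding eq by (rule cSup_upper) (use A that in auto)
qed

lemma fwd_jump_dense:
  assumes "x < b" "fwd_jump J x = x" "x < y"
  obtains d where "d \<in> J" "x < d" "d < y"
proof -
  have "Inf {s \<in> J. x < s} < y"
    using assms right_end by (auto simp: fwd_jump_def split: if_splits)
  then show thesis
    using cInf_lessD[of "{s \<in> J. x < s}" y] assms right_end that by auto
qed

lemma bwd_jump_dense:
  assumes "a < x" "bwd_jump J x = x" "y < x"
  obtains c where "c \<in> J" "y < c" "c < x"
proof -
  have "y < Sup {s \<in> J. s < x}"
    using assms left_end by (auto simp: bwd_jump_def split: if_splits)
  then show thesis
    using less_cSupD[of "{s \<in> J. s < x}" y] assms left_end that by auto
qed

lemma fwd_jump_max [simp]: "fwd_jump J b = b"
  using bounds by (force simp: fwd_jump_def)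

lemma right_dense_iff: "t \<in> J \<Longrightarrow> right_dense J t \<longleftrightarrow> t < b \<and> fwd_jump J t = t"
  using bounds right_end by (force simp: right_dense_def)

lemma left_dense_iff: "t \<in> J \<Longrightarrow> left_dense J t \<longleftrightarrow> a < t \<and> bwd_jump J t = t"
  using bounds left_end by (force simp: left_dense_def)

definition gap :: "real \<Rightarrow> real \<Rightarrow> bool" where
  "gap c d \<longleftrightarrow> c \<in> J \<and> d \<in> J \<and> c < d \<and> J \<inter> {c<..<d} = {}"

lemma gapD:
  assumes "gap c d"
  shows "c \<in> J" "d \<in> J" "c < d" "s \<in> J \<Longrightarrow> c < s \<Longrightarrow> d \<le> s" "s \<in> J \<Longrightarrow> s < d \<Longrightarrow> s \<le> c"
  using assms by (auto simp: gap_def disjoint_iff not_less[symmetric])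

lemma ts_floor_gap:
  assumes "gap c d" "c \<le> x" "x < d"
  shows "ts_floor J x = c"
  by (rule ts_floor_eqI) (use gapD(1)[OF assms(1)] gapD(5)[OF assms(1)] assms in auto)

lemma fwd_jump_gap:
  assumes "gap c d"
  shows "fwd_jump J c = d"
proof -
  have "Inf {s \<in> J. c < s} = d"
    by (rule cInf_eq_minimum) (use gapD[OF assms] in auto)
  then show ?thesis
    using gapD[OF assms] by (auto simp: fwd_jump_def)
qed

text \<open>The right and the left neighbourhood of any real number in the interval, whether or not it is a
  point of the time scale, either meet a single gap or contain time scale points arbitrarily close
  by.  Local arguments split along this dichotomy.\<close>

lemma right_cases:
  assumes "a \<le> x" "x < b"
  obtains (gap) c d where "gap c d" "c \<le> x" "x < d"
    | (dense) "x \<in> J" "fwd_jump J x = x"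
proof (cases "fwd_jump J x = x")
  case True
  then show thesis
    using dense fwd_jump_props(1)[OF assms(2)] by simp
next
  case False
  then have less: "x < fwd_jump J x"
    using fwd_jump_props(2)[OF assms(2)] by simp
  have "gap (ts_floor J x) (fwd_jump J x)"
    unfolding gap_def
  proof (intro conjI ts_floor_mem fwd_jump_props assms)
    show "ts_floor J x < fwd_jump J x"
      using less ts_floor_le[OF assms(1)] by simp
    show "J \<inter> {ts_floor J x<..<fwd_jump J x} = {}"
    proof (intro equals0I, elim IntE)
      fix s
      assume "s \<in> J" "s \<in> {ts_floor J x<..<fwd_jump J x}"
      then show False
        using ts_floor_ge[of s x] fwd_jump_props(3)[OF assms(2), of s] by (cases "s \<le> x") auto
    qed
  qed
  then show thesis
    using gap ts_floor_le[OF assms(1)] less by blast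
qed

lemma left_cases:
  assumes "a < x" "x \<le> b"
  obtains (gap) c d where "gap c d" "c < x" "x \<le> d"
    | (dense) "x \<in> J" "bwd_jump J x = x"
proof (cases "bwd_jump J x = x")
  case True
  then show thesis
    using dense bwd_jump_props(1)[OF assms(1)] by simp
next
  case False
  then have less: "bwd_jump J x < x"
    using bwd_jump_props(2)[OF assms(1)] by simp
  note B = bwd_jump_props[OF assms(1)]
  show thesis
  proof (rule right_cases[of "bwd_jump J x"])
    show "a \<le> bwd_jump J x" "bwd_jump J x < b"
      using bounds B less assms by auto
  next
    fix c d
    assume cd: "local.gap c d" "c \<le> bwd_jump J x" "bwd_jump J x < d"
    have "x \<le> d"
      using B(3)[of d] gapD[OF cd(1)] cd by force
    then show thesis
      using gap cd less by auto
  next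
    assume fix_pt: "fwd_jump J (bwd_jump J x) = bwd_jump J x"
    obtain d where "d \<in> J" "bwd_jump J x < d" "d < x"
      using fwd_jump_dense[OF _ fix_pt less] less assms by auto
    then show thesis
      using B(3)[of d] by auto
  qed
qed

lemma outside_gap:
  assumes "x \<in> {a..b}" "x \<notin> J"
  obtains c d where "gap c d" "c < x" "x < d"
proof -
  have "x < b"
    using assms right_end by (cases "x = b") auto
  then obtain c d where cd: "gap c d" "c \<le> x" "x < d"
    using right_cases[of x] assms by auto
  moreover have "c \<noteq> x"
    using gapD(1)[OF cd(1)] assms by auto
  ultimately show thesis
    using that by auto
qed

text \<open>A rational number chosen in each gap identifies the gap.\<close>

lemma countable_gap_ends:
  shows "countable {c. \<exists>d. gap c d}" "countable {d. \<exists>c. gap c d}"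
proof -
  have "\<exists>q. (\<exists>d. gap c d) \<longrightarrow> q \<in> \<rat> \<and> c < q \<and> q < fwd_jump J c" for c
  proof (cases "\<exists>d. gap c d")
    case True
    then have "c < fwd_jump J c"
      using gapD(3) fwd_jump_gap by force
    then show ?thesis
      using Rats_dense_in_real by blast
  qed blast
  then obtain q where q: "\<And>c d. gap c d \<Longrightarrow> q c \<in> \<rat> \<and> c < q c \<and> q c < fwd_jump J c"
    by metis
  have ne: "q c1 < q c2" if "gap c1 d1" "gap c2 d2" "c1 < c2" for c1 c2 d1 d2
    using q[OF that(1)] q[OF that(2)] gapD(4)[OF that(1) gapD(1)[OF that(2)] that(3)]
      fwd_jump_gap[OF that(1)] by simp
  have "inj_on q {c. \<exists>d. gap c d}"
    by (rule inj_onI, rule ccontr) (auto simp: neq_iff dest: ne)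
  moreover have "countable (q ` {c. \<exists>d. gap c d})"
    by (rule countable_subset[OF _ countable_rat]) (use q in auto)
  ultimately show c: "countable {c. \<exists>d. gap c d}"
    by (rule countable_image_inj_on[rotated])
  have "d \<in> fwd_jump J ` {c. \<exists>d. gap c d}" if cd: "gap c d" for c d
  proof (rule image_eqI)
    show "d = fwd_jump J c"
      using fwd_jump_gap[OF cd] by simp
    show "c \<in> {c. \<exists>d. gap c d}"
      using cd by (intro CollectI exI)
  qed
  then have "{d. \<exists>c. gap c d} \<subseteq> fwd_jump J ` {c. \<exists>d. gap c d}"
    by (intro subsetI) (elim CollectE exE)
  from countable_subset[OF this countable_image[OF c]] show "countable {d. \<exists>c. gap c d}" .
qed

section \<open>Delta antiderivatives as Henstock--Kurzweil integrals\<close>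

text \<open>On a gap \<open>[c, d)\<close> this is the line through \<open>(c, F c)\<close> with slope \<open>u c\<close>.  If \<open>F\<close> is an
  antiderivative of \<open>u\<close>, it also meets \<open>(d, F d)\<close>, so that it is the linear interpolation.\<close>

definition interpolant :: "(real \<Rightarrow> real) \<Rightarrow> (real \<Rightarrow> real) \<Rightarrow> real \<Rightarrow> real" where
  "interpolant F u x = F (ts_floor J x) + u (ts_floor J x) * (x - ts_floor J x)"

lemma interpolant_mem: "t \<in> J \<Longrightarrow> interpolant F u t = F t"
  by (simp add: interpolant_def ts_floor_id)

lemma interpolant_gap:
  assumes "gap c d" "F d = F c + u c * (d - c)" "c \<le> x" "x \<le> d"
  shows "interpolant F u x = F c + u c * (x - c)"
proof (cases "x = d")
  case True
  then show ?thesis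
    using assms gapD(2)[OF assms(1)] by (simp add: interpolant_mem)
next
  case False
  then show ?thesis
    using assms ts_floor_gap[OF assms(1,3)] by (simp add: interpolant_def)
qed

text \<open>An affine bound for the distance to an affine function need only be checked on the time
  scale, since on a gap everything in sight is affine.\<close>

lemma interpolant_affine_bound:
  assumes slope: "\<And>c d. gap c d \<Longrightarrow> F d = F c + u c * (d - c)"
    and cd: "c \<in> J" "d \<in> J" and y: "c \<le> y" "y \<le> d"
    and bound: "\<And>s. s \<in> J \<Longrightarrow> c \<le> s \<Longrightarrow> s \<le> d \<Longrightarrow> \<bar>F s - (m * s + k)\<bar> \<le> M * s + N"
  shows "\<bar>interpolant F u y - (m * y + k)\<bar> \<le> M * y + N"
proof (cases "y \<in> J")
  case True
  then show ?thesis
    using bound y by (simp add: interpolant_mem)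
next
  case False
  then obtain c' d' where g: "gap c' d'" "c' < y" "y < d'"
    using outside_gap[of y] cd y bounds by (metis atLeastAtMost_iff order_trans)
  have "c \<le> c'" "d' \<le> d"
    using gapD(5)[OF g(1) cd(1)] gapD(4)[OF g(1) cd(2)] y g by auto
  then have b: "\<bar>F c' - (m * c' + k)\<bar> \<le> M * c' + N" "\<bar>F d' - (m * d' + k)\<bar> \<le> M * d' + N"
    using bound[of c'] bound[of d'] gapD[OF g(1)] y g by auto
  have nonneg: "0 \<le> \<alpha> + \<beta> * y" if "0 \<le> \<alpha> + \<beta> * c'" "0 \<le> \<alpha> + \<beta> * d'" for \<alpha> \<beta> :: real
  proof (cases "\<beta> \<ge> 0")
    case True
    then have "\<beta> * c' \<le> \<beta> * y"
      using g by (intro mult_left_mono) auto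
    then show ?thesis
      using that by linarith
  next
    case False
    then have "\<beta> * d' \<le> \<beta> * y"
      using g by (intro mult_left_mono_neg) auto
    then show ?thesis
      using that by linarith
  qed
  have i: "interpolant F u y = F c' + u c' * (y - c')"
    using interpolant_gap[OF g(1)] slope[OF g(1)] g by simp
  have "interpolant F u y - (m * y + k) \<le> M * y + N"
    using nonneg[of "N + k - F c' + u c' * c'" "M + m - u c'"] b slope[OF g(1)]
    by (simp add: i algebra_simps abs_le_iff)
  moreover have "- (interpolant F u y - (m * y + k)) \<le> M * y + N"
    using nonneg[of "N - k + F c' - u c' * c'" "M - m + u c'"] b slope[OF g(1)]
    by (simp add: i algebra_simps abs_le_iff)
  ultimately show ?thesis
    by (rule abs_leI)
qed

text \<open>Continuity is checked on either side separately.  Next to a gap the interpolant is affine, and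
  next to a dense point \<open>x\<close> the bound \<open>\<bar>F s - F x\<bar> \<le> e / 2\<close> passes from the time scale to the
  gaps in between.\<close>

lemma continuous_on_interpolant:
  assumes cont: "continuous_on J F"
    and slope: "\<And>c d. gap c d \<Longrightarrow> F d = F c + u c * (d - c)"
  shows "continuous_on {a..b} (interpolant F u)"
proof -
  let ?I = "interpolant F u"
  have gap_lim: "(?I \<longlongrightarrow> ?I x) (at x within S)"
    if g: "gap c d" and x: "c \<le> x" "x \<le> d" and ev: "eventually (\<lambda>y. y \<in> {c..d}) (at x within S)"
    for c d x S
  proof -
    have "((\<lambda>y. F c + u c * (y - c)) \<longlongrightarrow> ?I x) (at x within S)"
      unfolding interpolant_gap[where F = F and u = u, OF g slope[OF g] x]
      by (intro tendsto_intros)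
    then show ?thesis
      by (rule Lim_transform_eventually)
        (use ev in \<open>auto elim!: eventually_mono simp: interpolant_gap[where F = F and u = u, OF g slope[OF g]]\<close>)
  qed
  have dense_lim: "(?I \<longlongrightarrow> ?I x) (at x within S)"
    if x: "x \<in> J" and ev: "\<And>e. e > 0 \<Longrightarrow> \<exists>c\<in>J. \<exists>d\<in>J. x - e < c \<and> c \<le> x \<and> x \<le> d \<and> d < x + e \<and>
      eventually (\<lambda>y. y \<in> {c..d}) (at x within S)"
    for x S
  proof (rule tendstoI)
    fix e :: real
    assume "e > 0"
    then obtain \<delta> where \<delta>: "\<delta> > 0" "\<And>s. s \<in> J \<Longrightarrow> \<bar>s - x\<bar> < \<delta> \<Longrightarrow> \<bar>F s - F x\<bar> < e / 2"
      using cont x unfolding continuous_on_iff dist_real_def by (meson half_gt_zero)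
    obtain c d where cd: "c \<in> J" "d \<in> J" "x - \<delta> < c" "c \<le> x" "x \<le> d" "d < x + \<delta>"
      and near: "eventually (\<lambda>y. y \<in> {c..d}) (at x within S)"
      using ev[OF \<delta>(1)] by blast
    have "\<bar>?I y - F x\<bar> \<le> e / 2" if "y \<in> {c..d}" for y
    proof -
      have "\<bar>?I y - (0 * y + F x)\<bar> \<le> 0 * y + e / 2"
      proof (rule interpolant_affine_bound[OF slope cd(1,2)])
        fix s
        assume "s \<in> J" "c \<le> s" "s \<le> d"
        moreover from this have "\<bar>s - x\<bar> < \<delta>"
          using cd by linarith
        ultimately have "\<bar>F s - F x\<bar> < e / 2"
          using \<delta>(2) by blast
        then show "\<bar>F s - (0 * s + F x)\<bar> \<le> 0 * s + e / 2"
          by simp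
      qed (use that in auto)
      then show ?thesis by simp
    qed
    then have "dist (?I y) (?I x) < e" if "y \<in> {c..d}" for y
      using that \<open>e > 0\<close> by (force simp: dist_real_def interpolant_mem[OF x])
    then show "eventually (\<lambda>y. dist (?I y) (?I x) < e) (at x within S)"
      using near by (auto elim: eventually_mono)
  qed
  have ev_right: "eventually (\<lambda>y. y \<in> {c..d}) (at x within {x..b})" if "c \<le> x" "x < d" for c d x
    unfolding eventually_at using that by (intro exI[of _ "d - x"]) (auto simp: dist_real_def)
  have ev_left: "eventually (\<lambda>y. y \<in> {c..d}) (at x within {a..x})" if "c < x" "x \<le> d" for c d x
    unfolding eventually_at using that by (intro exI[of _ "x - c"]) (auto simp: dist_real_def)
  have "(?I \<longlongrightarrow> ?I x) (at x within {a..b})" if x: "x \<in> {a..b}" for x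
  proof -
    have "(?I \<longlongrightarrow> ?I x) (at x within {x..b})"
    proof (cases "x = b")
      case False
      then have "a \<le> x" "x < b"
        using x by auto
      then show ?thesis
      proof (cases rule: right_cases)
        case (gap c d)
        then show ?thesis
          using gap_lim[OF gap(1)] ev_right by simp
      next
        case dense
        show ?thesis
        proof (rule dense_lim[OF dense(1)])
          fix e :: real
          assume "e > 0"
          then obtain d where "d \<in> J" "x < d" "d < x + e"
            using fwd_jump_dense[OF \<open>x < b\<close> dense(2), of "x + e"] by auto
          then show "\<exists>c\<in>J. \<exists>d\<in>J. x - e < c \<and> c \<le> x \<and> x \<le> d \<and> d < x + e \<and>
              eventually (\<lambda>y. y \<in> {c..d}) (at x within {x..b})"
            using dense(1) ev_right[of x x d] \<open>e > 0\<close> by (intro bexI[of _ x] bexI[of _ d]) auto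
        qed
      qed
    qed (simp add: tendsto_def eventually_at_filter)
    moreover have "(?I \<longlongrightarrow> ?I x) (at x within {a..x})"
    proof (cases "x = a")
      case False
      then have "a < x" "x \<le> b"
        using x by auto
      then show ?thesis
      proof (cases rule: left_cases)
        case (gap c d)
        then show ?thesis
          using gap_lim[OF gap(1)] ev_left by simp
      next
        case dense
        show ?thesis
        proof (rule dense_lim[OF dense(1)])
          fix e :: real
          assume "e > 0"
          then obtain c where "c \<in> J" "x - e < c" "c < x"
            using bwd_jump_dense[OF \<open>a < x\<close> dense(2), of "x - e"] by auto
          then show "\<exists>c\<in>J. \<exists>d\<in>J. x - e < c \<and> c \<le> x \<and> x \<le> d \<and> d < x + e \<and>
              eventually (\<lambda>y. y \<in> {c..d}) (at x within {a..x})"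
            using dense(1) ev_left[of c x x] \<open>e > 0\<close> by (intro bexI[of _ c] bexI[of _ x]) auto
        qed
      qed
    qed (simp add: tendsto_def eventually_at_filter)
    moreover have "{a..b} = {a..x} \<union> {x..b}"
      using x by auto
    ultimately show ?thesis
      by (simp add: Lim_within_Un)
  qed
  then show ?thesis
    by (auto simp: continuous_on_def)
qed

text \<open>The estimate of the delta derivative on the time scale has an affine right-hand side on either
  side of \<open>x\<close>, so that it extends to the gaps.\<close>

lemma interpolant_has_derivative_dense:
  assumes slope: "\<And>c d. gap c d \<Longrightarrow> F d = F c + u c * (d - c)"
    and x: "x \<in> J" "a < x" "x < b" "fwd_jump J x = x" "bwd_jump J x = x"
    and deriv: "has_delta_derivative J F (u x) x"
  shows "(interpolant F u has_vector_derivative u x) (at x within S)"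
  unfolding has_vector_derivative_def has_derivative_within_alt
proof (intro conjI bounded_linear_scaleR_left allI impI)
  fix e :: real
  assume e: "e > 0"
  obtain \<delta> where \<delta>: "\<delta> > 0" "\<And>s. s \<in> J \<Longrightarrow> \<bar>s - x\<bar> < \<delta> \<Longrightarrow> \<bar>F x - F s - u x * (x - s)\<bar> \<le> e * \<bar>x - s\<bar>"
    using deriv e x(4) unfolding has_delta_derivative_def by auto
  obtain d where d: "d \<in> J" "x < d" "d < x + \<delta>"
    using fwd_jump_dense[OF x(3,4), of "x + \<delta>"] \<delta>(1) by auto
  obtain c where c: "c \<in> J" "x - \<delta> < c" "c < x"
    using bwd_jump_dense[OF x(2,5), of "x - \<delta>"] \<delta>(1) by auto
  have *: "\<bar>F s - (u x * s + (F x - u x * x))\<bar> \<le> e * \<bar>x - s\<bar>" if "s \<in> J" "c \<le> s" "s \<le> d" for s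
    using \<delta>(2)[OF that(1)] that c d by (simp add: algebra_simps abs_le_iff)
  have right: "\<bar>interpolant F u y - (u x * y + (F x - u x * x))\<bar> \<le> e * y + (- e * x)"
    if "x \<le> y" "y \<le> d" for y
    by (rule interpolant_affine_bound[OF slope x(1) d(1) that])
      (use * c in \<open>force simp: algebra_simps\<close>)+
  have left: "\<bar>interpolant F u y - (u x * y + (F x - u x * x))\<bar> \<le> (- e) * y + e * x"
    if "c \<le> y" "y \<le> x" for y
    by (rule interpolant_affine_bound[OF slope c(1) x(1) that])
      (use * d in \<open>force simp: algebra_simps\<close>)+
  have "norm (interpolant F u y - interpolant F u x - (y - x) *\<^sub>R u x) \<le> e * norm (y - x)"
    if "norm (y - x) < min (x - c) (d - x)" for y
    using right[of y] left[of y] that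
    by (cases "x \<le> y") (auto simp: interpolant_mem[OF x(1)] algebra_simps abs_le_iff)
  then show "\<exists>\<delta>>0. \<forall>y\<in>S. norm (y - x) < \<delta> \<longrightarrow>
      norm (interpolant F u y - interpolant F u x - (y - x) *\<^sub>R u x) \<le> e * norm (y - x)"
    using c d by (intro exI[of _ "min (x - c) (d - x)"]) auto
qed

lemma interpolant_has_derivative_gap:
  assumes g: "gap c d" "F d = F c + u c * (d - c)" and x: "c < x" "x < d" "x \<in> S"
  shows "(interpolant F u has_vector_derivative step_extension J u x) (at x within S)"
proof -
  have "((\<lambda>y. F c + u c * (y - c)) has_vector_derivative u c) (at x within S)"
    by (auto intro!: derivative_eq_intros)
  then have "(interpolant F u has_vector_derivative u c) (at x within S)"
    by (rule has_vector_derivative_transform_within[where d = "min (x - c) (d - x)"])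
      (use x in \<open>auto simp: dist_real_def interpolant_gap[where F = F and u = u, OF g]\<close>)
  then show ?thesis
    using ts_floor_gap[OF g(1), of x] x by (simp add: step_extension_def)
qed

text \<open>The defining estimate of the delta derivative at \<open>c\<close>, taken at \<open>s = c\<close> itself, bounds the
  difference of the two sides by every positive multiple of \<open>d - c\<close>.\<close>

lemma slope_pre_antiderivative:
  assumes "pre_antiderivative J u F" "gap c d"
  shows "F d = F c + u c * (d - c)"
proof -
  note g = gapD[OF assms(2)]
  have "c \<in> ts_kappa J" "right_scattered J c"
    using g fwd_jump_gap[OF assms(2)] by (force simp: ts_kappa_def right_scattered_def)+
  then have "has_delta_derivative J F (u c) c"
    using assms(1) unfolding pre_antiderivative_def by blast
  then have "\<bar>F d - F c - u c * (d - c)\<bar> \<le> \<epsilon> * \<bar>d - c\<bar>" if "\<epsilon> > 0" for \<epsilon>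
    using g(1) that fwd_jump_gap[OF assms(2)] unfolding has_delta_derivative_def
    by (metis abs_zero diff_self)
  then have "\<bar>F d - F c - u c * (d - c)\<bar> \<le> 0 + e" if "e > 0" for e
    using g(3) that by (metis abs_of_pos add_0 diff_gt_0_iff_gt divide_pos_pos nonzero_eq_divide_eq order_less_irrefl)
  then have "\<bar>F d - F c - u c * (d - c)\<bar> \<le> 0"
    by (rule field_le_epsilon)
  then show ?thesis
    by simp
qed

text \<open>Outside the end points, the countably many gap ends and the exceptional set, the interpolant
  is differentiable with derivative \<open>step_extension J u\<close>.\<close>

proposition pre_antiderivative_has_integral:
  assumes F: "pre_antiderivative J u F"
  shows "(step_extension J u has_integral (F b - F a)) {a..b}"
proof -
  obtain D where D: "countable (ts_kappa J - D)" "\<And>t. t \<in> D \<Longrightarrow> has_delta_derivative J F (u t) t"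
    and cont: "continuous_on J F"
    using F unfolding pre_antiderivative_def by blast
  note slope = slope_pre_antiderivative[OF F]
  let ?S = "{a, b} \<union> (ts_kappa J - D) \<union> {c. \<exists>d. gap c d} \<union> {d. \<exists>c. gap c d}"
  have "(step_extension J u has_integral (interpolant F u b - interpolant F u a)) {a..b}"
  proof (rule has_integral_derivative_off_countable[OF ends_le])
    show "countable ?S"
      using D countable_gap_ends by simp
    show "continuous_on {a..b} (interpolant F u)"
      by (rule continuous_on_interpolant[OF cont slope])
    fix x
    assume x: "x \<in> {a..b} - ?S"
    then have ab: "a < x" "x < b"
      by auto
    show "(interpolant F u has_vector_derivative step_extension J u x) (at x within {a..b})"
    proof (cases "x \<in> J")
      case True
      have "a \<le> x" "x \<le> b"
        using ab by auto
      have "fwd_jump J x = x"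
        using \<open>a \<le> x\<close> ab(2)
      proof (cases rule: right_cases)
        case (gap c d)
        then show ?thesis
          using x True gapD(5)[OF gap(1) True] by (cases "c = x") auto
      qed
      moreover have "bwd_jump J x = x"
        using ab(1) \<open>x \<le> b\<close>
      proof (cases rule: left_cases)
        case (gap c d)
        then show ?thesis
          using x True gapD(4)[OF gap(1) True] by (cases "d = x") auto
      qed
      moreover have "x \<in> ts_kappa J"
        using True ab right_end by (force simp: ts_kappa_def)
      then have "has_delta_derivative J F (u x) x"
        using x D(2) by auto
      ultimately have "(interpolant F u has_vector_derivative u x) (at x within {a..b})"
        using interpolant_has_derivative_dense[OF slope True ab] by simp
      then show ?thesis
        by (simp add: step_extension_mem True)
    next
      case False
      then obtain c d where "gap c d" "c < x" "x < d"
        using outside_gap x by blast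
      then show ?thesis
        using interpolant_has_derivative_gap slope ab by auto
    qed
  qed
  then show ?thesis
    by (simp add: interpolant_mem left_end right_end)
qed

section \<open>Existence of delta antiderivatives\<close>

text \<open>Between two points \<open>s\<close> and \<open>t\<close> of the time scale, the step extension only takes values of \<open>u\<close> at
  points of the time scale between them.  So a continuity estimate for \<open>u\<close> within the time scale
  carries over to the integral, whether \<open>s\<close> and \<open>t\<close> are dense or scattered.\<close>

lemma step_extension_bound:
  assumes int: "step_extension J u integrable_on {a..b}" and st: "s \<in> J" "t \<in> J" "s \<le> t"
    and bound: "\<And>r. r \<in> J \<Longrightarrow> s \<le> r \<Longrightarrow> r \<le> t \<Longrightarrow> \<bar>u r - k\<bar> \<le> e" and e: "0 \<le> e"
  shows "\<bar>integral {a..t} (step_extension J u) - integral {a..s} (step_extension J u) - k * (t - s)\<bar>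
    \<le> e * (t - s)"
proof -
  let ?v = "step_extension J u"
  have sub: "?v integrable_on {c..d}" if "a \<le> c" "d \<le> b" for c d
    by (rule integrable_subinterval_real[OF int]) (use that in auto)
  have "integral {a..s} ?v + integral {s..t} ?v = integral {a..t} ?v"
    by (rule Henstock_Kurzweil_Integration.integral_combine) (use st bounds in \<open>auto intro!: sub\<close>)
  moreover have "((\<lambda>x. ?v x - k) has_integral integral {s..t} ?v - k * (t - s)) (cbox s t)"
    using has_integral_const_real[of k s t] sub[of s t] bounds[OF st(1)] bounds[OF st(2)] st(3)
    by (auto intro!: has_integral_diff integrable_integral simp: mult.commute)
  then have "norm (integral {s..t} ?v - k * (t - s)) \<le> e * measure lborel (cbox s t)"
  proof (rule has_integral_bound[OF e])
    fix x
    assume "x \<in> cbox s t"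
    then have x: "s \<le> x" "x \<le> t" "a \<le> x"
      using bounds(1)[OF st(1)] by auto
    show "norm (?v x - k) \<le> e"
      using bound[OF ts_floor_mem[OF x(3)]] ts_floor_ge[OF st(1) x(1)] ts_floor_le[OF x(3)] x(2)
      by (simp add: step_extension_def)
  qed
  ultimately show ?thesis
    using st(3) by (simp add: algebra_simps)
qed

lemma step_extension_gap_integral:
  assumes int: "step_extension J u integrable_on {a..b}" and g: "gap c d"
  shows "integral {a..d} (step_extension J u) - integral {a..c} (step_extension J u) = u c * (d - c)"
proof -
  let ?v = "step_extension J u"
  note g' = gapD[OF g]
  have "?v integrable_on {a..d}"
    by (rule integrable_subinterval_real[OF int]) (use bounds(2)[OF g'(2)] in auto)
  then have "integral {a..c} ?v + integral {c..d} ?v = integral {a..d} ?v"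
    using bounds(1)[OF g'(1)] g'(3) by (intro Henstock_Kurzweil_Integration.integral_combine) auto
  moreover have "(?v has_integral u c * (d - c)) {c..d}"
  proof (rule has_integral_spike_finite)
    show "((\<lambda>_. u c) has_integral u c * (d - c)) {c..d}"
      using has_integral_const_real[of "u c" c d] g'(3) by (simp add: mult.commute)
    show "?v x = u c" if "x \<in> {c..d} - {d}" for x
      using that ts_floor_gap[OF g, of x] by (simp add: step_extension_def)
  qed simp
  ultimately show ?thesis
    by (simp add: integral_unique)
qed

text \<open>Only the two end points of the time scale can be exceptional: at \<open>a\<close> the function \<open>u\<close> may be
  singular, and at a left-dense \<open>b\<close> it may have a jump.\<close>

proposition pre_antiderivative_integral:
  assumes int: "step_extension J u integrable_on {a..b}"
    and cont: "\<And>t. t \<in> J \<Longrightarrow> a < t \<Longrightarrow> right_dense J t \<Longrightarrow> continuous (at t within J) u"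
  shows "pre_antiderivative J u (\<lambda>t. integral {a..t} (step_extension J u))"
proof -
  let ?F = "\<lambda>t. integral {a..t} (step_extension J u)"
  let ?E = "{t \<in> {a, b}. \<not> right_scattered J t}"
  have F_cont: "continuous_on J ?F"
    using indefinite_integral_continuous_1[OF int] subset continuous_on_subset by blast
  have deriv: "has_delta_derivative J ?F (u t) t" if t: "t \<in> ts_kappa J - ?E" for t
  proof -
    have tJ: "t \<in> J"
      using t by (auto simp: ts_kappa_def)
    have "t < b"
    proof (rule ccontr)
      assume "\<not> t < b"
      then have "t = b"
        using bounds(2)[OF tJ] by simp
      then show False
        using t by (simp add: right_scattered_def)
    qed
    show ?thesis
    proof (cases "right_scattered J t")
      case True
      define d where "d = fwd_jump J t"
      have d: "t < d"
        using True by (simp add: right_scattered_def d_def)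
      have g: "gap t d"
        using bounds(1)[OF tJ] \<open>t < b\<close>
      proof (cases rule: right_cases)
        case (gap c d')
        then have "c = t"
          using gapD(5)[OF gap(1) tJ] by simp
        then show ?thesis
          using gap fwd_jump_gap d_def by simp
      qed (use d d_def in simp)
      have F_gap: "?F d - ?F t = u t * (d - t)"
        by (rule step_extension_gap_integral[OF int g])
      show ?thesis
        unfolding has_delta_derivative_def d_def[symmetric]
      proof (intro allI impI)
        fix e :: real
        assume e: "e > 0"
        \<comment> \<open>Close to \<open>t\<close>, the length \<open>d - s\<close> is at least \<open>(d - t) / 2\<close>; two errors of \<open>\<eta>\<close> are allowed.\<close>
        define \<eta> where "\<eta> = e * (d - t) / 4"
        have \<eta>: "\<eta> > 0"
          using e d by (simp add: \<eta>_def)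
        obtain \<delta> where \<delta>: "\<delta> > 0" "\<And>s. s \<in> J \<Longrightarrow> \<bar>s - t\<bar> < \<delta> \<Longrightarrow> \<bar>?F s - ?F t\<bar> < \<eta>"
          using F_cont tJ \<eta> unfolding continuous_on_iff dist_real_def by meson
        define \<delta>' where "\<delta>' = min (min \<delta> ((d - t) / 2)) (\<eta> / (\<bar>u t\<bar> + 1))"
        have "\<bar>?F d - ?F s - u t * (d - s)\<bar> \<le> e * \<bar>d - s\<bar>" if s: "s \<in> J" "\<bar>s - t\<bar> < \<delta>'" for s
        proof -
          have "\<bar>u t * (t - s)\<bar> \<le> (\<bar>u t\<bar> + 1) * (\<eta> / (\<bar>u t\<bar> + 1))"
            unfolding abs_mult by (intro mult_mono) (use s \<eta> in \<open>auto simp: \<delta>'_def\<close>)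
          also have "\<dots> = \<eta>"
            by simp
          finally have "\<bar>u t * (t - s)\<bar> \<le> \<eta>" .
          moreover have "\<bar>?F s - ?F t\<bar> < \<eta>"
            using s by (intro \<delta>(2)) (auto simp: \<delta>'_def)
          moreover have "?F d - ?F s - u t * (d - s) = - (?F s - ?F t) - u t * (t - s)"
            using F_gap by (simp add: algebra_simps)
          ultimately have "\<bar>?F d - ?F s - u t * (d - s)\<bar> \<le> \<eta> + \<eta>"
            by linarith
          also have "\<dots> = e * ((d - t) / 2)"
            by (simp add: \<eta>_def)
          also have "\<dots> \<le> e * \<bar>d - s\<bar>"
            using s e by (intro mult_left_mono) (auto simp: \<delta>'_def abs_if split: if_splits)
          finally show ?thesis .
        qed
        moreover have "\<delta>' > 0"
          using \<delta>(1) d \<eta> by (simp add: \<delta>'_def)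
        ultimately show "\<exists>\<delta>>0. \<forall>s\<in>J. \<bar>s - t\<bar> < \<delta> \<longrightarrow> \<bar>?F d - ?F s - u t * (d - s)\<bar> \<le> e * \<bar>d - s\<bar>"
          by blast
      qed
    next
      case False
      then have fwd: "fwd_jump J t = t"
        using fwd_jump_props(2)[OF \<open>t < b\<close>] by (simp add: right_scattered_def)
      have "a < t"
        using False t bounds(1)[OF tJ] by (cases "a = t") auto
      then have u: "continuous (at t within J) u"
        using cont tJ fwd \<open>t < b\<close> by (simp add: right_dense_iff)
      show ?thesis
        unfolding has_delta_derivative_def fwd
      proof (intro allI impI)
        fix e :: real
        assume e: "e > 0"
        then obtain \<delta> where \<delta>: "\<delta> > 0" "\<And>r. r \<in> J \<Longrightarrow> \<bar>r - t\<bar> < \<delta> \<Longrightarrow> \<bar>u r - u t\<bar> < e"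
          using u unfolding continuous_within_eps_delta dist_real_def by metis
        have "\<bar>?F t - ?F s - u t * (t - s)\<bar> \<le> e * \<bar>t - s\<bar>" if s: "s \<in> J" "\<bar>s - t\<bar> < \<delta>" for s
        proof (cases "s \<le> t")
          case True
          have "\<bar>?F t - ?F s - u t * (t - s)\<bar> \<le> e * (t - s)"
            using s True e by (intro step_extension_bound[OF int s(1) tJ True] less_imp_le[OF \<delta>(2)]) auto
          then show ?thesis
            using True by simp
        next
          case False
          then have "\<bar>?F s - ?F t - u t * (s - t)\<bar> \<le> e * (s - t)"
            using s e by (intro step_extension_bound[OF int tJ s(1)] less_imp_le[OF \<delta>(2)]) auto
          then show ?thesis
            using False by (simp add: algebra_simps abs_le_iff)
        qed
        then show "\<exists>\<delta>>0. \<forall>s\<in>J. \<bar>s - t\<bar> < \<delta> \<longrightarrow> \<bar>?F t - ?F s - u t * (t - s)\<bar> \<le> e * \<bar>t - s\<bar>"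
          using \<delta>(1) by blast
      qed
    qed
  qed
  have "countable (ts_kappa J - (ts_kappa J - ?E))"
    by (rule countable_subset[of _ "{a, b}"]) auto
  then show ?thesis
    unfolding pre_antiderivative_def
    using F_cont deriv by (intro conjI exI[of _ "ts_kappa J - ?E"]) auto
qed

section \<open>Rd-continuous functions\<close>

text \<open>Next to a gap the step extension is constant.  Next to a dense point it inherits the limit of
  \<open>f\<close> along the time scale, since \<open>ts_floor J y\<close> tends to \<open>x\<close> together with \<open>y\<close>.\<close>

lemma step_extension_right_limit:
  assumes f: "rd_continuous J f" and x: "a \<le> x" "x < b"
  shows "\<exists>l. (step_extension J f \<longlongrightarrow> l) (at_right x)"
  using x
proof (cases rule: right_cases)
  case (gap c d)
  have "eventually (\<lambda>y. step_extension J f y = f c) (at_right x)"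
    unfolding eventually_at_right_field
    using gap ts_floor_gap[OF gap(1)] by (intro exI[of _ d]) (auto simp: step_extension_def)
  then show ?thesis
    using tendsto_eventually by blast
next
  case dense
  then have cont: "continuous (at x within J) f"
    using f x unfolding rd_continuous_def by (simp add: right_dense_iff)
  have right: "eventually (\<lambda>y. x < y) (at_right x)"
    by (rule eventually_at_right_less)
  have "(ts_floor J \<longlongrightarrow> x) (at_right x)"
  proof (rule tendsto_sandwich)
    show "eventually (\<lambda>y. x \<le> ts_floor J y) (at_right x)"
      using right dense by (auto elim!: eventually_mono intro: ts_floor_ge)
    show "eventually (\<lambda>y. ts_floor J y \<le> y) (at_right x)"
      using right x by (auto elim!: eventually_mono intro: ts_floor_le)
  qed auto
  moreover have "eventually (\<lambda>y. ts_floor J y \<in> J) (at_right x)"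
    using right x by (auto elim!: eventually_mono intro: ts_floor_mem)
  ultimately show ?thesis
    using continuous_within_tendsto_compose[OF cont] unfolding step_extension_def by blast
qed

lemma step_extension_left_limit:
  assumes f: "rd_continuous J f" and x: "a < x" "x \<le> b"
  shows "\<exists>l. (step_extension J f \<longlongrightarrow> l) (at_left x)"
  using x
proof (cases rule: left_cases)
  case (gap c d)
  have "eventually (\<lambda>y. step_extension J f y = f c) (at_left x)"
    unfolding eventually_at_left_field
    using gap ts_floor_gap[OF gap(1)] by (intro exI[of _ c]) (auto simp: step_extension_def)
  then show ?thesis
    using tendsto_eventually by blast
next
  case dense
  then obtain l where l: "(f \<longlongrightarrow> l) (at x within (J \<inter> {..<x}))"
    using f x unfolding rd_continuous_def by (auto simp: left_dense_iff)
  have left: "eventually (\<lambda>y. z < y \<and> y < x) (at_left x)" if "z < x" for z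
    using that unfolding eventually_at_left_field by blast
  have "(ts_floor J \<longlongrightarrow> x) (at_left x)"
  proof (rule order_tendstoI)
    fix z
    assume "z < x"
    then obtain c where c: "c \<in> J" "z < c" "c < x"
      using bwd_jump_dense[OF x(1) dense(2)] by blast
    show "eventually (\<lambda>y. z < ts_floor J y) (at_left x)"
      using left[OF c(3)] 
    proof eventually_elim
      case (elim y)
      then show ?case
        using c ts_floor_ge[OF c(1), of y] by linarith
    qed
  next
    fix z
    assume "x < z"
    show "eventually (\<lambda>y. ts_floor J y < z) (at_left x)"
      using left[OF x(1)] 
    proof eventually_elim
      case (elim y)
      then show ?case
        using \<open>x < z\<close> ts_floor_le[of y] by linarith
    qed
  qed
  moreover have "eventually (\<lambda>y. ts_floor J y \<in> J \<inter> {..<x} \<and> ts_floor J y \<noteq> x) (at_left x)"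
    using left[OF x(1)]
  proof eventually_elim
    case (elim y)
    then show ?case
      using ts_floor_mem[of y] ts_floor_le[of y] by auto
  qed
  ultimately have "filterlim (ts_floor J) (at x within (J \<inter> {..<x})) (at_left x)"
    by (simp add: filterlim_at)
  then show ?thesis
    using filterlim_compose[OF l] unfolding step_extension_def by blast
qed

proposition rd_continuous_integrable: "rd_continuous J f \<Longrightarrow> step_extension J f integrable_on {a..b}"
  by (intro regulated_integrable_on step_extension_left_limit step_extension_right_limit)

end

lemma rd_continuous_compose:
  assumes f: "rd_continuous J f" and \<phi>: "continuous_on UNIV \<phi>"
  shows "rd_continuous J (\<lambda>t. \<phi> (f t))"
proof -
  have "isCont \<phi> y" for y
    using \<phi> by (simp add: continuous_on_eq_continuous_at)
  then show ?thesis
    using f unfolding rd_continuous_def by (blast intro: continuous_within_compose3 isCont_tendsto_compose)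
qed

lemma rd_continuous_mult:
  assumes "rd_continuous J f" "rd_continuous J g"
  shows "rd_continuous J (\<lambda>t. f t * g t)"
  using assms unfolding rd_continuous_def by (blast intro: continuous_mult tendsto_mult)

lemma continuous_on_imp_rd_continuous: "continuous_on J f \<Longrightarrow> rd_continuous J f"
  unfolding rd_continuous_def continuous_on_eq_continuous_within
  by (auto simp: continuous_within intro: tendsto_within_subset)

section \<open>Fractional integrals\<close>

context compact_time_scale
begin

proposition frac_integral_has_integral:
  assumes "frac_integrable J \<alpha> \<phi>"
  shows "(step_extension J (\<lambda>t. \<phi> t * frac_weight \<alpha> t) has_integral frac_integral J \<alpha> a b \<phi>) {a..b}"
proof -
  have "pre_antiderivative J (\<lambda>t. \<phi> t * frac_weight \<alpha> t) (indefinite_frac_integral J \<alpha> \<phi>)"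
    using assms
    unfolding frac_integrable_def delta_integrable_def indefinite_frac_integral_def
      indefinite_delta_integral_def by (rule someI_ex)
  then show ?thesis
    unfolding frac_integral_def by (rule pre_antiderivative_has_integral)
qed

lemma continuous_on_frac_weight: "\<alpha> = 1 \<or> A \<subseteq> {0<..} \<Longrightarrow> continuous_on A (frac_weight \<alpha>)"
  by (cases "\<alpha> = 1") (auto simp: frac_weight_def intro!: continuous_on_powr')

text \<open>The weight is continuous at every point of the time scale except possibly at \<open>a = 0\<close>, where an
  antiderivative need not be differentiable.\<close>

lemma frac_integrableI:
  assumes \<phi>: "rd_continuous J \<phi>" and weight: "\<alpha> = 1 \<or> 0 \<le> a"
    and int: "step_extension J (\<lambda>t. \<phi> t * frac_weight \<alpha> t) integrable_on {a..b}"
  shows "frac_integrable J \<alpha> \<phi>"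
proof -
  have "continuous (at t within J) (\<lambda>t. \<phi> t * frac_weight \<alpha> t)"
    if t: "t \<in> J" "a < t" "right_dense J t" for t
  proof (rule continuous_mult)
    show "continuous (at t within J) \<phi>"
      using \<phi> t unfolding rd_continuous_def by blast
    have "continuous_on (if \<alpha> = 1 then UNIV else {0<..}) (frac_weight \<alpha>)"
      by (intro continuous_on_frac_weight) auto
    then have "continuous (at t) (frac_weight \<alpha>)"
      by (rule continuous_on_interior) (use t weight in \<open>auto simp: interior_open\<close>)
    then show "continuous (at t within J) (frac_weight \<alpha>)"
      by (rule continuous_at_imp_continuous_at_within)
  qed
  then show ?thesis
    using pre_antiderivative_integral[OF int]
    unfolding frac_integrable_def delta_integrable_def by blast
qed

lemma rd_continuous_frac_integrable:
  assumes \<phi>: "rd_continuous J \<phi>" and adm: "frac_admissible J \<alpha> a \<phi>"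
  shows "frac_integrable J \<alpha> \<phi>"
proof (cases "\<alpha> = 1 \<or> a > 0")
  case True
  then have "continuous_on J (frac_weight \<alpha>)"
    using bounds(1) by (intro continuous_on_frac_weight) force
  then have "rd_continuous J (\<lambda>t. \<phi> t * frac_weight \<alpha> t)"
    by (intro rd_continuous_mult \<phi> continuous_on_imp_rd_continuous)
  then show ?thesis
    using True by (intro frac_integrableI \<phi> rd_continuous_integrable) auto
next
  case False
  then show ?thesis
    using adm by (simp add: frac_admissible_def)
qed

text \<open>The weight composed with the monotone function \<open>ts_floor J\<close> is measurable even when its
  singularity keeps it from being integrable.\<close>

lemma measurable_step_extension_weighted:
  assumes "rd_continuous J \<phi>"
  shows "step_extension J (\<lambda>t. \<phi> t * frac_weight \<alpha> t) \<in> borel_measurable (lebesgue_on {a..b})"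
proof -
  have "frac_weight \<alpha> \<in> borel_measurable borel"
    unfolding frac_weight_def by measurable
  moreover have "ts_floor J \<in> borel_measurable (lebesgue_on {a..b})"
    by (rule integrable_imp_measurable[OF integrable_on_mono_on[OF ts_floor_mono_on]])
  ultimately have "(\<lambda>x. frac_weight \<alpha> (ts_floor J x)) \<in> borel_measurable (lebesgue_on {a..b})"
    by (rule measurable_compose[rotated])
  moreover have "step_extension J \<phi> \<in> borel_measurable (lebesgue_on {a..b})"
    by (rule integrable_imp_measurable[OF rd_continuous_integrable[OF assms]])
  ultimately show ?thesis
    unfolding step_extension_def by (rule borel_measurable_times[rotated])
qed

text \<open>A comparison test for improper integrals: this is where the integral of the product comes from
  when the weight is singular.\<close>

lemma frac_integrable_dominated:
  assumes \<phi>: "rd_continuous J \<phi>" and weight: "\<alpha> = 1 \<or> 0 \<le> a"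
    and \<psi>: "step_extension J (\<lambda>t. \<psi> t * frac_weight \<alpha> t) integrable_on {a..b}"
    and bound: "\<And>t. t \<in> J \<Longrightarrow> \<bar>\<phi> t\<bar> \<le> \<psi> t"
  shows "frac_integrable J \<alpha> \<phi>"
proof (rule frac_integrableI[OF \<phi> weight])
  show "step_extension J (\<lambda>t. \<phi> t * frac_weight \<alpha> t) integrable_on {a..b}"
  proof (rule measurable_bounded_by_integrable_imp_integrable[OF _ \<psi>])
    fix x
    assume "x \<in> {a..b}"
    then show "norm (step_extension J (\<lambda>t. \<phi> t * frac_weight \<alpha> t) x)
        \<le> step_extension J (\<lambda>t. \<psi> t * frac_weight \<alpha> t) x"
      using bound[OF ts_floor_mem] by (auto simp: step_extension_def frac_weight_def abs_mult mult_right_mono)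
  qed (use measurable_step_extension_weighted[OF \<phi>] in auto)
qed

proposition Holder_frac_integral:
  assumes f: "rd_continuous J f" and g: "rd_continuous J g" and h: "rd_continuous J h"
    and p: "p > 1" and pq: "1 / p + 1 / q = 1"
    and adm: "frac_admissible J \<alpha> a (\<lambda>t. \<bar>f t\<bar> powr p * \<bar>h t\<bar>)"
      "frac_admissible J \<alpha> a (\<lambda>t. \<bar>g t\<bar> powr q * \<bar>h t\<bar>)"
  shows "frac_integral J \<alpha> a b (\<lambda>t. \<bar>f t * g t\<bar> * \<bar>h t\<bar>)
    \<le> frac_integral J \<alpha> a b (\<lambda>t. \<bar>f t\<bar> powr p * \<bar>h t\<bar>) powr (1 / p)
     * frac_integral J \<alpha> a b (\<lambda>t. \<bar>g t\<bar> powr q * \<bar>h t\<bar>) powr (1 / q)"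
proof -
  have q: "q > 1"
    using p pq by (smt (verit) divide_less_eq_1_pos zero_less_divide_1_iff)
  have rd: "rd_continuous J (\<lambda>t. \<bar>u t\<bar> powr r * \<bar>h t\<bar>)" if "rd_continuous J u" "r > 1" for u r
  proof -
    have "continuous_on UNIV (\<lambda>x::real. \<bar>x\<bar> powr r)" "continuous_on UNIV (\<lambda>x::real. \<bar>x\<bar>)"
      using that(2) by (auto intro!: continuous_on_powr' continuous_on_rabs)
    then show ?thesis
      by (intro rd_continuous_mult rd_continuous_compose[OF that(1)] rd_continuous_compose[OF h])
  qed
  have rd_fgh: "rd_continuous J (\<lambda>t. \<bar>f t * g t\<bar> * \<bar>h t\<bar>)"
    by (intro rd_continuous_mult rd_continuous_compose[OF rd_continuous_mult[OF f g]] rd_continuous_compose[OF h])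
      (auto intro!: continuous_intros)
  note int_f = frac_integral_has_integral[OF rd_continuous_frac_integrable[OF rd[OF f p] adm(1)]]
  note int_g = frac_integral_has_integral[OF rd_continuous_frac_integrable[OF rd[OF g q] adm(2)]]
  have "frac_integrable J \<alpha> (\<lambda>t. \<bar>f t * g t\<bar> * \<bar>h t\<bar>)"
  proof (rule frac_integrable_dominated[OF rd_fgh])
    show "\<alpha> = 1 \<or> 0 \<le> a"
      using adm by (auto simp: frac_admissible_def)
    show "step_extension J (\<lambda>t. (\<bar>f t\<bar> powr p * \<bar>h t\<bar> + \<bar>g t\<bar> powr q * \<bar>h t\<bar>) * frac_weight \<alpha> t)
        integrable_on {a..b}"
      using has_integral_integrable[OF has_integral_add[OF int_f int_g]]
      by (simp add: step_extension_def[abs_def] algebra_simps)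
    fix t
    have "\<bar>f t\<bar> * \<bar>g t\<bar> \<le> \<bar>f t\<bar> powr p / p + \<bar>g t\<bar> powr q / q"
      by (intro Youngs_inequality p q pq) auto
    also have "\<dots> \<le> \<bar>f t\<bar> powr p + \<bar>g t\<bar> powr q"
      using p q by (intro add_mono) (auto simp: divide_le_eq mult_le_cancel_left1)
    finally have "\<bar>f t\<bar> * \<bar>g t\<bar> * \<bar>h t\<bar> \<le> (\<bar>f t\<bar> powr p + \<bar>g t\<bar> powr q) * \<bar>h t\<bar>"
      by (intro mult_right_mono) auto
    then show "\<bar>\<bar>f t * g t\<bar> * \<bar>h t\<bar>\<bar> \<le> \<bar>f t\<bar> powr p * \<bar>h t\<bar> + \<bar>g t\<bar> powr q * \<bar>h t\<bar>"
      by (simp add: abs_mult distrib_right)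
  qed
  note int_fg = frac_integral_has_integral[OF this]
  show ?thesis
  proof (rule Holder_has_integral[OF p pq])
    show "((\<lambda>x. step_extension J (\<lambda>t. \<bar>f t\<bar>) x powr p
        * step_extension J (\<lambda>t. \<bar>h t\<bar> * frac_weight \<alpha> t) x)
        has_integral frac_integral J \<alpha> a b (\<lambda>t. \<bar>f t\<bar> powr p * \<bar>h t\<bar>)) {a..b}"
      using int_f by (simp add: step_extension_def[abs_def] mult.assoc)
    show "((\<lambda>x. step_extension J (\<lambda>t. \<bar>g t\<bar>) x powr q
        * step_extension J (\<lambda>t. \<bar>h t\<bar> * frac_weight \<alpha> t) x)
        has_integral frac_integral J \<alpha> a b (\<lambda>t. \<bar>g t\<bar> powr q * \<bar>h t\<bar>)) {a..b}"
      using int_g by (simp add: step_extension_def[abs_def] mult.assoc)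
    show "((\<lambda>x. step_extension J (\<lambda>t. \<bar>f t\<bar>) x * step_extension J (\<lambda>t. \<bar>g t\<bar>) x
        * step_extension J (\<lambda>t. \<bar>h t\<bar> * frac_weight \<alpha> t) x)
        has_integral frac_integral J \<alpha> a b (\<lambda>t. \<bar>f t * g t\<bar> * \<bar>h t\<bar>)) {a..b}"
      using int_fg by (simp add: step_extension_def[abs_def] mult.assoc abs_mult)
  qed (auto simp: step_extension_def frac_weight_def)
qed

end

section \<open>Intervals of an arbitrary time scale\<close>

lemma compact_time_scale_ts_interval:
  assumes "time_scale T" "a \<in> T" "b \<in> T" "a \<le> b"
  shows "compact_time_scale (ts_interval T a b) a b"
proof
  have "ts_interval T a b = T \<inter> {a..b}"
    by (auto simp: ts_interval_def)
  then show "closed (ts_interval T a b)"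
    using assms by (simp add: time_scale_def closed_Int)
qed (use assms in \<open>auto simp: ts_interval_def\<close>)

theorem theorem7:
  fixes T :: "real set" and \<alpha> a b p q :: real and f g h :: "real \<Rightarrow> real"
  assumes "time_scale T"
    and "0 < \<alpha>" and "\<alpha> \<le> 1"
    and "a \<in> T" and "b \<in> T" and "a \<le> b"
    and "rd_continuous (ts_interval T a b) f"
    and "rd_continuous (ts_interval T a b) g"
    and "rd_continuous (ts_interval T a b) h"
    and "p > 1" and "1 / p + 1 / q = 1"
    and "frac_admissible (ts_interval T a b) \<alpha> a (\<lambda>t. \<bar>f t\<bar> powr p * \<bar>h t\<bar>)"
    and "frac_admissible (ts_interval T a b) \<alpha> a (\<lambda>t. \<bar>g t\<bar> powr q * \<bar>h t\<bar>)"
  shows "frac_integral (ts_interval T a b) \<alpha> a b (\<lambda>t. \<bar>f t * g t\<bar> * \<bar>h t\<bar>)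
    \<le> (frac_integral (ts_interval T a b) \<alpha> a b (\<lambda>t. \<bar>f t\<bar> powr p * \<bar>h t\<bar>)) powr (1 / p)
     * (frac_integral (ts_interval T a b) \<alpha> a b (\<lambda>t. \<bar>g t\<bar> powr q * \<bar>h t\<bar>)) powr (1 / q)"
proof -
  interpret compact_time_scale "ts_interval T a b" a b
    by (rule compact_time_scale_ts_interval) (use assms in auto)
  show ?thesis
    by (rule Holder_frac_integral) (use assms in auto)
qed

end
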